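(* Let $d \ge 3$ and let $P$ be a simplicial $d$-polytope. Every nontrivial minimum edge cut in the graph of $P$ has at least $d(d+1)/2$ edges.
   Context: A polytope is the convex hull of finitely many points; its dimension is the dimension of its affine hull, and a $d$-polytope is a polytope of dimension $d$. Its faces are its intersections with its supporting hyperplanes, together with the polytope itself. A polytope is simplicial when all its proper faces are simplices. The graph of a polytope has as vertices its $0$-dimensional faces and as edges its $1$-dimensional faces. For a connected graph $G$ with vertex set $V$, an edge cut is a set $\mathcal{E}(V_\circ, V_\bullet)$ consisting of all edges with one endpoint in $V_\circ$ and the other in $V_\bullet$, for some partition $V = V_\circ \sqcup V_\bullet$ with $V_\circ \neq \varnothing \neq V_\bullet$. A minimum edge cut is an edge cut of minimal cardinality among all edge cuts of $G$. An edge cut is trivial if it is the set of all edges incident to some given vertex, and nontrivial otherwise. *)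

theory Defs
  imports "HOL-Analysis.Polytope"
begin

text \<open>A graph is given by its vertex set \<open>V\<close> and its set \<open>E\<close> of edges, each a set of two vertices.\<close>

definition edges_between :: "'v set set \<Rightarrow> 'v set \<Rightarrow> 'v set \<Rightarrow> 'v set set" where
  "edges_between E A B = {e \<in> E. \<exists>a\<in>A. \<exists>b\<in>B. e = {a, b}}"

definition edge_cut :: "'v set \<Rightarrow> 'v set set \<Rightarrow> 'v set set \<Rightarrow> bool" where
  "edge_cut V E C \<longleftrightarrow>
     (\<exists>A B. A \<union> B = V \<and> A \<inter> B = {} \<and> A \<noteq> {} \<and> B \<noteq> {} \<and> C = edges_between E A B)"

definition minimum_edge_cut :: "'v set \<Rightarrow> 'v set set \<Rightarrow> 'v set set \<Rightarrow> bool" where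
  "minimum_edge_cut V E C \<longleftrightarrow>
     edge_cut V E C \<and> (\<forall>C'. edge_cut V E C' \<longrightarrow> card C \<le> card C')"

definition trivial_edge_cut :: "'v set \<Rightarrow> 'v set set \<Rightarrow> 'v set set \<Rightarrow> bool" where
  "trivial_edge_cut V E C \<longleftrightarrow> edge_cut V E C \<and> (\<exists>v\<in>V. C = {e \<in> E. v \<in> e})"

text \<open>
  A face is a set \<open>F\<close> with \<open>F exposed_face_of P\<close>: the intersection of \<open>P\<close> with a supporting
  hyperplane, or \<open>P\<close> itself, or the empty set. The empty face is a simplex of dimension \<open>-1\<close>, so
  it puts no constraint on simplicial polytopes.
\<close>

definition simplicial_polytope :: "'a::euclidean_space set \<Rightarrow> bool" where
  "simplicial_polytope P \<longleftrightarrow>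
     polytope P \<and> (\<forall>F. F exposed_face_of P \<and> F \<noteq> P \<longrightarrow> (\<exists>n. n simplex F))"

text \<open>A 0-dimensional face \<open>{v}\<close> is identified with the point \<open>v\<close>.\<close>

definition polytope_vertices :: "'a::euclidean_space set \<Rightarrow> 'a set" where
  "polytope_vertices P = {v. {v} exposed_face_of P}"

text \<open>A 1-dimensional face is represented by the set of its two endpoints.\<close>

definition polytope_edges :: "'a::euclidean_space set \<Rightarrow> 'a set set" where
  "polytope_edges P =
     (\<lambda>e. e \<inter> polytope_vertices P) ` {e. e exposed_face_of P \<and> aff_dim e = 1}"

lemma polytope_edge_endpoints:
  assumes P: "polytope P" and e: "e exposed_face_of P" "aff_dim e = 1"
  obtains u v where "u \<noteq> v" "e = closed_segment u v" "e \<inter> polytope_vertices P = {u, v}"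
proof -
  have fe: "e face_of P"
    using e(1) by (simp add: exposed_face_of_def)
  have "polytope e"
    using P fe face_of_polytope_polytope by blast
  then obtain u v where uv: "e = closed_segment u v"
    using e(2) compact_convex_collinear_segment[of e] polytope_imp_compact polytope_imp_convex
      collinear_aff_dim[of e] by (metis aff_dim_empty order_refl one_neq_neg_one)
  have "u \<noteq> v"
    using e(2) uv by auto
  have ex: "F exposed_face_of P \<longleftrightarrow> F face_of P" for F
    using P exposed_face_of_polyhedron polytope_imp_polyhedron by blast
  have "e \<inter> polytope_vertices P = {x. x extreme_point_of e}"
    using extreme_point_of_face[OF fe]
    by (auto simp: polytope_vertices_def ex face_of_singleton)
  also have "\<dots> = {u, v}"
    by (auto simp: uv extreme_point_of_segment)
  finally show thesis
    using that \<open>u \<noteq> v\<close> uv by blast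
qed

lemma inj_on_polytope_edge_endpoints:
  assumes "polytope P"
  shows "inj_on (\<lambda>e. e \<inter> polytope_vertices P) {e. e exposed_face_of P \<and> aff_dim e = 1}"
proof (rule inj_onI, clarsimp)
  fix e f
  assume e: "e exposed_face_of P" "aff_dim e = 1" and f: "f exposed_face_of P" "aff_dim f = 1"
    and eq: "e \<inter> polytope_vertices P = f \<inter> polytope_vertices P"
  obtain a b where "e = closed_segment a b" "e \<inter> polytope_vertices P = {a, b}"
    using polytope_edge_endpoints[OF assms e] .
  moreover obtain c d where "f = closed_segment c d" "f \<inter> polytope_vertices P = {c, d}"
    using polytope_edge_endpoints[OF assms f] .
  ultimately show "e = f"
    using eq by (metis doubleton_eq_iff closed_segment_commute)
qed

lemma finite_polytope_edges: "polytope P \<Longrightarrow> finite (polytope_edges P)"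
  unfolding polytope_edges_def
  by (rule finite_imageI, rule finite_subset[OF _ finite_polyhedron_exposed_faces])
     (auto intro: polytope_imp_polyhedron)

end

theory Submission
  imports Defs
begin

text \<open>
  Let \<open>(A, B)\<close> be the partition behind a nontrivial minimum cut \<open>C\<close>, and read \<open>C\<close> as a bipartite
  graph between \<open>A\<close> and \<open>B\<close>. The bound \<open>d (d + 1) / 2 = d + d (d - 1) / 2\<close> comes from two facts.

  \<^item> \<open>C\<close> contains \<open>d\<close> pairwise disjoint edges. By Koenig's theorem (\<open>koenig_matching\<close>) it is enough
    that fewer than \<open>d\<close> vertices never cover \<open>C\<close>. Each side has at least \<open>d\<close> vertices, because a
    smaller side with at least two vertices sends too many edges across when all degrees are at
    least \<open>max (card C) d\<close> (\<open>nontrivial_minimum_cut_side_ge\<close>). So deleting fewer than \<open>d\<close> vertices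
    leaves vertices on both sides, and Balinski's theorem provides an edge between them.

  \<^item> Every edge of \<open>C\<close> shares an endpoint with at least \<open>d - 1\<close> other edges of \<open>C\<close>. Indeed two
    adjacent vertices have at least \<open>d - 1\<close> common neighbours (\<open>common_neighbours_ge\<close>), and whichever
    side a common neighbour lies on, one of its edges to the two endpoints is in \<open>C\<close>.

  The \<open>d\<close> matching edges thus meet \<open>d (d - 1)\<close> edges, counted with multiplicity, and an edge
  outside the matching meets at most two matching edges.

  Balinski's theorem is proved here for simplicial polytopes
  (\<open>simplicial_polytope_removal_connected\<close>): a linear functional constant on the deleted vertices
  and on one more vertex is chosen, and one climbs along edges to its maximal face
  (\<open>ascending_neighbour\<close>), which is a simplex and hence has a complete graph.
\<close>

section \<open>Matchings and covers in bipartite graphs\<close>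

text \<open>
  A bipartite graph is a set of pairs, so the two sides are disjoint by construction and a vertex
  cover splits into its parts \<open>X\<close> and \<open>Y\<close>. These are finite because an infinite set has \<open>card\<close> zero.
\<close>

definition bipartite_cover :: "('a \<times> 'b) set \<Rightarrow> 'a set \<Rightarrow> 'b set \<Rightarrow> bool" where
  "bipartite_cover R X Y \<longleftrightarrow> finite X \<and> finite Y \<and> (\<forall>(a, b)\<in>R. a \<in> X \<or> b \<in> Y)"

definition cover_number_ge :: "nat \<Rightarrow> ('a \<times> 'b) set \<Rightarrow> bool" where
  "cover_number_ge k R \<longleftrightarrow> (\<forall>X Y. bipartite_cover R X Y \<longrightarrow> k \<le> card X + card Y)"

lemma cover_number_ge_swap:
  "cover_number_ge k (prod.swap ` R) \<longleftrightarrow> cover_number_ge k R"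
proof -
  have "bipartite_cover (prod.swap ` R) X Y \<longleftrightarrow> bipartite_cover R Y X" for X Y
    unfolding bipartite_cover_def by auto
  then show ?thesis
    unfolding cover_number_ge_def by (metis add.commute)
qed

text \<open>
  If two edges \<open>(x, y1)\<close> and \<open>(x, y2)\<close> were present, criticality gives for each of them a cover of
  the remaining edges by fewer than \<open>k\<close> vertices, avoiding \<open>x\<close>. Uncrossing the two covers, that is,
  intersecting on one side and uniting on the other, yields two covers of the whole graph, once \<open>x\<close>
  is added to one of them. Their sizes add up to at most \<open>2 k - 1\<close>, so one is too small.
\<close>

lemma critical_imp_inj_on_fst:
  assumes R: "cover_number_ge k R"
    and crit: "\<And>e. e \<in> R \<Longrightarrow> \<not> cover_number_ge k (R - {e})"
  shows "inj_on fst R"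
proof (rule ccontr)
  assume "\<not> inj_on fst R"
  then obtain x y1 y2 where e: "(x, y1) \<in> R" "(x, y2) \<in> R" "y1 \<noteq> y2"
    unfolding inj_on_def by (metis prod.collapse)
  obtain X1 Y1 where 1: "bipartite_cover (R - {(x, y1)}) X1 Y1" "card X1 + card Y1 < k"
    using crit[OF e(1)] unfolding cover_number_ge_def by (meson not_le)
  obtain X2 Y2 where 2: "bipartite_cover (R - {(x, y2)}) X2 Y2" "card X2 + card Y2 < k"
    using crit[OF e(2)] unfolding cover_number_ge_def by (meson not_le)
  have fin: "finite X1" "finite Y1" "finite X2" "finite Y2"
    using 1 2 by (auto simp: bipartite_cover_def)
  have "x \<notin> X1"
  proof
    assume "x \<in> X1"
    then have "bipartite_cover R X1 Y1"
      using 1(1) by (auto simp: bipartite_cover_def)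
    then show False
      using R 1(2) unfolding cover_number_ge_def by (meson not_le)
  qed
  have "x \<notin> X2"
  proof
    assume "x \<in> X2"
    then have "bipartite_cover R X2 Y2"
      using 2(1) by (auto simp: bipartite_cover_def)
    then show False
      using R 2(2) unfolding cover_number_ge_def by (meson not_le)
  qed
  have y: "y2 \<in> Y1" "y1 \<in> Y2"
    using 1(1) 2(1) e \<open>x \<notin> X1\<close> \<open>x \<notin> X2\<close> by (auto simp: bipartite_cover_def)
  have "bipartite_cover R (X1 \<inter> X2) (Y1 \<union> Y2)"
    using 1(1) 2(1) y by (auto simp: bipartite_cover_def)
  then have "k \<le> card (X1 \<inter> X2) + card (Y1 \<union> Y2)"
    using R by (auto simp: cover_number_ge_def)
  moreover have "bipartite_cover R (insert x (X1 \<union> X2)) (Y1 \<inter> Y2)"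
    using 1(1) 2(1) by (auto simp: bipartite_cover_def)
  then have "k \<le> card (insert x (X1 \<union> X2)) + card (Y1 \<inter> Y2)"
    using R by (auto simp: cover_number_ge_def)
  then have "k \<le> Suc (card (X1 \<union> X2)) + card (Y1 \<inter> Y2)"
    using fin by (auto simp: card_insert_if split: if_splits)
  moreover have "card (X1 \<union> X2) + card (X1 \<inter> X2) = card X1 + card X2"
      "card (Y1 \<union> Y2) + card (Y1 \<inter> Y2) = card Y1 + card Y2"
    using fin card_Un_Int[of X1 X2] card_Un_Int[of Y1 Y2] by auto
  ultimately show False
    using 1(2) 2(2) by linarith
qed

text \<open>
  Koenig's theorem. An inclusion-minimal subgraph that still needs \<open>k\<close> cover vertices is a matching,
  by the preceding lemma applied to it and to its mirror image; the first endpoints of a matching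
  cover it, so it has at least \<open>k\<close> edges.
\<close>

lemma koenig_matching:
  assumes "finite R" "cover_number_ge k R"
  obtains M where "M \<subseteq> R" "inj_on fst M" "inj_on snd M" "card M = k"
proof -
  define \<F> where "\<F> = {M. M \<subseteq> R \<and> cover_number_ge k M}"
  have "finite \<F>" "R \<in> \<F>"
    using assms by (auto simp: \<F>_def)
  then obtain M where M: "M \<in> \<F>" "\<And>N. N \<in> \<F> \<Longrightarrow> N \<subseteq> M \<Longrightarrow> N = M"
    using finite_has_minimal2[of \<F> R] by metis
  have MR: "M \<subseteq> R" "cover_number_ge k M"
    using M(1) by (auto simp: \<F>_def)
  have crit: "\<not> cover_number_ge k (M - {e})" if "e \<in> M" for e
    using M(2)[of "M - {e}"] that MR by (auto simp: \<F>_def)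
  have fst: "inj_on fst M"
    using critical_imp_inj_on_fst[OF MR(2) crit] .
  have "inj_on fst (prod.swap ` M)"
  proof (rule critical_imp_inj_on_fst)
    show "cover_number_ge k (prod.swap ` M)"
      using MR by (simp add: cover_number_ge_swap)
    fix e assume "e \<in> prod.swap ` M"
    then have e: "prod.swap e \<in> M" "prod.swap ` M - {e} = prod.swap ` (M - {prod.swap e})"
      by auto
    then show "\<not> cover_number_ge k (prod.swap ` M - {e})"
      using crit by (simp add: cover_number_ge_swap)
  qed
  then have snd: "inj_on snd M"
    by (intro inj_onI) (metis fst_swap image_eqI inj_onD swap_swap)
  have "finite M"
    using MR(1) assms(1) finite_subset by blast
  then have "bipartite_cover M (fst ` M) {}"
    by (force simp: bipartite_cover_def)
  then have "k \<le> card M"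
    using MR(2) card_image[OF fst] unfolding cover_number_ge_def by fastforce
  then obtain N where "N \<subseteq> M" "card N = k"
    using obtain_subset_with_card_n by metis
  then show thesis
    using that[of N] MR(1) inj_on_subset[OF fst] inj_on_subset[OF snd] by simp
qed

text \<open>
  Double counting of the pairs of a matching edge and an edge outside the matching that meets it:
  an edge outside meets at most one matching edge at each of its two endpoints.
\<close>

lemma card_ge_of_matching:
  assumes "finite R" "M \<subseteq> R" "inj_on fst M" "inj_on snd M"
    and nb: "\<And>e. e \<in> M \<Longrightarrow> t \<le> card {r \<in> R. r \<noteq> e \<and> (fst r = fst e \<or> snd r = snd e)}"
  shows "card M * (t + 2) \<le> 2 * card R"
proof -
  define N where "N e r \<longleftrightarrow> fst r = fst e \<or> snd r = snd e" for e r :: "'a \<times> 'b"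
  have fin: "finite M"
    using assms finite_subset by blast
  have eq: "{r \<in> R. r \<noteq> e \<and> N e r} = {r \<in> R - M. N e r}" if "e \<in> M" for e
    using assms(2-4) that by (auto simp: N_def inj_on_def)
  have le2: "card {e \<in> M. N e r} \<le> 2" for r
  proof -
    have "card {e \<in> M. fst e = fst r} \<le> Suc 0" "card {e \<in> M. snd e = snd r} \<le> Suc 0"
      using assms(3,4) fin by (auto simp: card_le_Suc0_iff_eq inj_on_def)
    moreover have "{e \<in> M. N e r} = {e \<in> M. fst e = fst r} \<union> {e \<in> M. snd e = snd r}"
      by (auto simp: N_def)
    ultimately show ?thesis
      using card_Un_le[of "{e \<in> M. fst e = fst r}" "{e \<in> M. snd e = snd r}"] by simp
  qed
  have "card M * t = (\<Sum>e\<in>M. t)"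
    by simp
  also have "\<dots> \<le> (\<Sum>e\<in>M. card {r \<in> R - M. N e r})"
    using nb eq by (intro sum_mono) (auto simp: N_def)
  also have "\<dots> = (\<Sum>r\<in>R - M. card {e \<in> M. N e r})"
    using sum.swap_restrict[of M "R - M" "\<lambda>_ _. 1 :: nat" N] fin assms(1) by simp
  also have "\<dots> \<le> (\<Sum>r\<in>R - M. 2)"
    using le2 by (rule sum_mono)
  also have "\<dots> = 2 * card (R - M)"
    by simp
  finally have "card M * t \<le> 2 * card (R - M)" .
  moreover have "card R = card M + card (R - M)"
    using assms(1,2) fin by (metis card_Diff_subset card_mono le_add_diff_inverse)
  ultimately show ?thesis
    by (simp add: algebra_simps)
qed

section \<open>Edge cuts in highly connected graphs\<close>

lemma edges_between_commute: "edges_between E A B = edges_between E B A"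
  unfolding edges_between_def by (intro Collect_cong) (metis insert_commute)

lemma card_edges_between:
  assumes "A \<inter> B = {}"
  shows "card (edges_between E A B) = card {(a, b) \<in> A \<times> B. {a, b} \<in> E}"
proof -
  have "edges_between E A B = (\<lambda>(a, b). {a, b}) ` {(a, b) \<in> A \<times> B. {a, b} \<in> E}"
    unfolding edges_between_def by force
  moreover have "inj_on (\<lambda>(a, b). {a, b}) {(a, b) \<in> A \<times> B. {a, b} \<in> E}"
    using assms by (auto simp: inj_on_def doubleton_eq_iff)
  ultimately show ?thesis
    by (simp add: card_image)
qed

definition simple_graph :: "'v set \<Rightarrow> 'v set set \<Rightarrow> bool" where
  "simple_graph V E \<longleftrightarrow> (\<forall>e\<in>E. \<exists>u\<in>V. \<exists>v\<in>V. u \<noteq> v \<and> e = {u, v})"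

lemma simple_graph_edgeD:
  assumes "simple_graph V E" "{u, v} \<in> E"
  shows "u \<in> V" "v \<in> V" "u \<noteq> v"
proof -
  obtain x y where "x \<in> V" "y \<in> V" "x \<noteq> y" "{u, v} = {x, y}"
    using assms unfolding simple_graph_def by meson
  then show "u \<in> V" "v \<in> V" "u \<noteq> v"
    by (auto simp: doubleton_eq_iff)
qed

lemma simple_graph_incidentE:
  assumes "simple_graph V E" "e \<in> E" "a \<in> e"
  obtains w where "e = {a, w}"
proof -
  obtain x y where "e = {x, y}"
    using assms unfolding simple_graph_def by meson
  then show thesis
    using that[of x] that[of y] assms(3) by (auto simp: insert_commute)
qed

lemma edges_at_vertex:
  assumes E: "simple_graph V E"
  shows "edges_between E {a} (V - {a}) = {e \<in> E. a \<in> e}"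
    and "card {e \<in> E. a \<in> e} = card {w. {a, w} \<in> E}"
proof -
  show "edges_between E {a} (V - {a}) = {e \<in> E. a \<in> e}"
  proof (intro equalityI subsetI)
    fix e assume "e \<in> {e \<in> E. a \<in> e}"
    then have e: "e \<in> E" "a \<in> e" by auto
    then obtain w where "e = {a, w}"
      using simple_graph_incidentE[OF E] by blast
    then show "e \<in> edges_between E {a} (V - {a})"
      using simple_graph_edgeD[OF E, of a w] e by (auto simp: edges_between_def)
  qed (auto simp: edges_between_def)
  have "{e \<in> E. a \<in> e} = (\<lambda>w. {a, w}) ` {w. {a, w} \<in> E}"
    using simple_graph_incidentE[OF E] by blast
  moreover have "inj_on (\<lambda>w. {a, w}) {w. {a, w} \<in> E}"
    by (auto simp: inj_on_def doubleton_eq_iff)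
  ultimately show "card {e \<in> E. a \<in> e} = card {w. {a, w} \<in> E}"
    by (simp add: card_image)
qed

text \<open>
  Balinski's form of \<open>d\<close>-connectedness. It speaks of partitions instead of paths because this is how
  it is applied to cuts and how it is derived for polytopes.
\<close>

definition removal_connected :: "nat \<Rightarrow> 'v set \<Rightarrow> 'v set set \<Rightarrow> bool" where
  "removal_connected d V E \<longleftrightarrow>
     (\<forall>S A B. S \<subseteq> V \<and> card S < d \<and> A \<union> B = V - S \<and> A \<inter> B = {} \<and> A \<noteq> {} \<and> B \<noteq> {}
        \<longrightarrow> (\<exists>a\<in>A. \<exists>b\<in>B. {a, b} \<in> E))"

text \<open>
  The neighbours of \<open>a\<close> separate \<open>a\<close> from the rest of the graph.
\<close>

lemma degree_ge:
  assumes "finite V" "d < card V" "removal_connected d V E"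
    and E: "simple_graph V E"
    and "a \<in> V"
  shows "d \<le> card {w. {a, w} \<in> E}"
proof (rule ccontr)
  let ?S = "{w. {a, w} \<in> E}"
  assume "\<not> d \<le> card ?S"
  then have less: "card ?S < d" by simp
  have S: "?S \<subseteq> V" "a \<notin> ?S"
    using simple_graph_edgeD[OF E] by blast+
  have fin: "finite ?S"
    using S \<open>finite V\<close> finite_subset by blast
  have "card (insert a ?S) < card V"
    using less assms(2) fin S by simp
  then have "V - ?S - {a} \<noteq> {}"
    using card_mono[of "insert a ?S" V] fin by fastforce
  moreover have "{a} \<union> (V - ?S - {a}) = V - ?S"
    using S \<open>a \<in> V\<close> by auto
  ultimately obtain b where "b \<in> V - ?S - {a}" "{a, b} \<in> E"
    using assms(3)[unfolded removal_connected_def, rule_format, of ?S "{a}" "V - ?S - {a}"] less S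
    by auto
  then show False by simp
qed

text \<open>
  Put \<open>k = card A\<close> and \<open>M = max (card C) d\<close>. All degrees are at least \<open>M\<close>, by \<open>degree_ge\<close> and because
  the trivial cuts compete with \<open>C\<close>. At most \<open>k - 1\<close> neighbours of a vertex in \<open>A\<close> lie in \<open>A\<close>, so
  \<open>k (M - k + 1) \<le> card C \<le> M\<close>, that is, \<open>(k - 1) (M - k) \<le> 0\<close>. This excludes \<open>2 \<le> k < d\<close>, and \<open>k = 1\<close>
  is the trivial case.
\<close>

lemma nontrivial_minimum_cut_side_ge:
  assumes "finite V" "d < card V" "removal_connected d V E"
    and E: "simple_graph V E"
    and min: "minimum_edge_cut V E C" and nontriv: "\<not> trivial_edge_cut V E C"
    and AB: "A \<union> B = V" "A \<inter> B = {}" "A \<noteq> {}" and C: "C = edges_between E A B"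
  shows "d \<le> card A"
proof (rule ccontr)
  assume "\<not> d \<le> card A"
  then have kd: "card A < d" by simp
  have fin: "finite A" "finite B"
    using AB \<open>finite V\<close> by auto
  have "card A \<noteq> 1"
  proof
    assume "card A = 1"
    then obtain a where a: "A = {a}" by (auto simp: card_1_singleton_iff)
    then have "B = V - {a}" "a \<in> V" using AB by auto
    then have "C = {e \<in> E. a \<in> e}"
      using edges_at_vertex(1)[OF E] C a by simp
    then show False
      using min nontriv \<open>a \<in> V\<close> by (auto simp: trivial_edge_cut_def minimum_edge_cut_def)
  qed
  then have k2: "2 \<le> card A"
    using AB(3) fin by (metis One_nat_def Suc_leI card_gt_0_iff le_neq_implies_less numeral_2_eq_2)
  define M where "M = max (card C) d"
  have deg: "M \<le> card {w. {a, w} \<in> E}" if "a \<in> A" for a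
  proof -
    have "a \<in> V" using that AB by auto
    have "V - {a} \<noteq> {}"
    proof
      assume "V - {a} = {}"
      then have "card V \<le> 1"
        using card_mono[of "{a}" V] by auto
      then show False using kd k2 assms(2) by linarith
    qed
    then have "edge_cut V E (edges_between E {a} (V - {a}))"
      unfolding edge_cut_def using \<open>a \<in> V\<close>
      by (intro exI[of _ "{a}"] exI[of _ "V - {a}"]) blast
    then have "card C \<le> card {w. {a, w} \<in> E}"
      using min edges_at_vertex[OF E, of a] unfolding minimum_edge_cut_def by metis
    then show ?thesis
      using degree_ge[OF assms(1-4) \<open>a \<in> V\<close>] by (simp add: M_def)
  qed
  have out: "M \<le> card {b \<in> B. {a, b} \<in> E} + (card A - 1)" if "a \<in> A" for a
  proof -
    have "{w. {a, w} \<in> E} \<subseteq> {b \<in> B. {a, b} \<in> E} \<union> (A - {a})"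
      using simple_graph_edgeD[OF E] AB(1) by blast
    then have "card {w. {a, w} \<in> E} \<le> card ({b \<in> B. {a, b} \<in> E} \<union> (A - {a}))"
      using fin by (intro card_mono) auto
    also have "\<dots> \<le> card {b \<in> B. {a, b} \<in> E} + card (A - {a})"
      by (rule card_Un_le)
    finally show ?thesis
      using deg[OF that] that fin by simp
  qed
  have "card A * M = (\<Sum>a\<in>A. M)"
    by simp
  also have "\<dots> \<le> (\<Sum>a\<in>A. card {b \<in> B. {a, b} \<in> E} + (card A - 1))"
    using out by (rule sum_mono)
  also have "\<dots> = (\<Sum>a\<in>A. card {b \<in> B. {a, b} \<in> E}) + card A * (card A - 1)"
    by (simp add: sum.distrib)
  also have "(\<Sum>a\<in>A. card {b \<in> B. {a, b} \<in> E}) = card C"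
  proof -
    have "{(a, b) \<in> A \<times> B. {a, b} \<in> E} = Sigma A (\<lambda>a. {b \<in> B. {a, b} \<in> E})"
      by auto
    then show ?thesis
      using card_edges_between[OF AB(2), of E] C fin by simp
  qed
  finally have "card A * M \<le> M + card A * (card A - 1)"
    by (simp add: M_def)
  moreover have "card A + 1 \<le> M"
    using kd by (auto simp: M_def)
  then obtain j where "M = card A + 1 + j"
    using le_Suc_ex by blast
  moreover obtain k where "card A = k + 2"
    using k2 by (metis add.commute le_Suc_ex)
  ultimately show False
    by (simp add: algebra_simps)
qed

text \<open>
  The purely combinatorial form of the result: it applies to every graph that is \<open>d\<close>-connected and
  in which adjacent vertices have \<open>d - 1\<close> common neighbours.
\<close>

lemma card_nontrivial_minimum_cut_ge:
  assumes "finite V" "d < card V" "removal_connected d V E"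
    and E: "simple_graph V E"
    and common: "\<And>u v. {u, v} \<in> E \<Longrightarrow> d - 1 \<le> card {w. {u, w} \<in> E \<and> {v, w} \<in> E}"
    and min: "minimum_edge_cut V E C" and nontriv: "\<not> trivial_edge_cut V E C"
  shows "d * (d + 1) \<le> 2 * card C"
proof -
  obtain A B where AB: "A \<union> B = V" "A \<inter> B = {}" "A \<noteq> {}" "B \<noteq> {}"
    and C: "C = edges_between E A B"
    using min by (auto simp: minimum_edge_cut_def edge_cut_def)
  have dA: "d \<le> card A"
    using nontrivial_minimum_cut_side_ge[OF assms(1-4) min nontriv AB(1-3) C] .
  have dB: "d \<le> card B"
    using nontrivial_minimum_cut_side_ge[OF assms(1-4) min nontriv, of B A] AB C
    by (simp add: edges_between_commute Un_commute Int_commute)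
  have fin: "finite A" "finite B"
    using AB \<open>finite V\<close> by auto
  define R where "R = {(a, b) \<in> A \<times> B. {a, b} \<in> E}"
  have "finite R"
    using fin by (auto simp: R_def intro: finite_subset[of _ "A \<times> B"])
  have "cover_number_ge d R"
    unfolding cover_number_ge_def
  proof (intro allI impI, rule ccontr)
    fix X Y assume cov: "bipartite_cover R X Y" and "\<not> d \<le> card X + card Y"
    then have less: "card X + card Y < d" and XY: "finite X" "finite Y"
      by (auto simp: bipartite_cover_def)
    let ?S = "(X \<union> Y) \<inter> V"
    have "card ?S \<le> card (X \<union> Y)"
      using XY by (intro card_mono) auto
    then have S: "card ?S < d"
      using less card_Un_le[of X Y] by linarith
    have "A - ?S \<noteq> {}" "B - ?S \<noteq> {}"
      using S dA dB card_mono[of ?S A] card_mono[of ?S B] \<open>finite V\<close> by fastforce+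
    moreover have "(A - ?S) \<union> (B - ?S) = V - ?S" "(A - ?S) \<inter> (B - ?S) = {}"
      using AB by auto
    ultimately obtain a b where "a \<in> A - ?S" "b \<in> B - ?S" "{a, b} \<in> E"
      using assms(3)[unfolded removal_connected_def, rule_format, of ?S "A - ?S" "B - ?S"] S
      by blast
    then show False
      using cov AB(1) by (auto simp: bipartite_cover_def R_def)
  qed
  then obtain M where M: "M \<subseteq> R" "inj_on fst M" "inj_on snd M" "card M = d"
    using koenig_matching[OF \<open>finite R\<close>] by metis
  have "d - 1 \<le> card {r \<in> R. r \<noteq> e \<and> (fst r = fst e \<or> snd r = snd e)}" if "e \<in> M" for e
  proof -
    have "e \<in> R"
      using that M(1) by blast
    then obtain u v where e: "e = (u, v)" "u \<in> A" "v \<in> B" "{u, v} \<in> E"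
      by (auto simp: R_def)
    let ?W = "{w. {u, w} \<in> E \<and> {v, w} \<in> E}"
    have W: "w \<in> V \<and> w \<noteq> u \<and> w \<noteq> v" if "w \<in> ?W" for w
      using that simple_graph_edgeD[OF E] by blast
    \<comment> \<open>Of the two edges joining a common neighbour \<open>w\<close> to \<open>u\<close> and \<open>v\<close>, pick the one in the cut.\<close>
    define \<phi> where "\<phi> w = (if w \<in> A then (w, v) else (u, w))" for w
    have "inj_on \<phi> ?W"
      using W by (auto simp: inj_on_def \<phi>_def split: if_splits)
    moreover have "\<phi> ` ?W \<subseteq> {r \<in> R. r \<noteq> e \<and> (fst r = fst e \<or> snd r = snd e)}"
      using W AB(1,2) e by (auto simp: \<phi>_def R_def insert_commute)
    ultimately have "card ?W \<le> card {r \<in> R. r \<noteq> e \<and> (fst r = fst e \<or> snd r = snd e)}"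
      using \<open>finite R\<close> by (intro card_inj_on_le) auto
    then show ?thesis
      using common[OF e(4)] by linarith
  qed
  then have "d * (d - 1 + 2) \<le> 2 * card R"
    using card_ge_of_matching[OF \<open>finite R\<close> M(1-3), of "d - 1"] M(4) by simp
  moreover have "card C = card R"
    using card_edges_between[OF AB(2), of E] C by (simp add: R_def)
  ultimately show ?thesis
    by (cases d) auto
qed

section \<open>Faces of simplicial polytopes\<close>

lemma mem_polytope_vertices_iff:
  assumes "polytope P"
  shows "v \<in> polytope_vertices P \<longleftrightarrow> v extreme_point_of P"
  using exposed_face_of_polyhedron[OF polytope_imp_polyhedron[OF assms]]
  by (simp add: polytope_vertices_def face_of_singleton)

lemma finite_polytope_vertices:
  assumes "polytope P"
  shows "finite (polytope_vertices P)"
proof -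
  have "polytope_vertices P = {v. v extreme_point_of P}"
    using mem_polytope_vertices_iff[OF assms] by blast
  then show ?thesis
    using finite_polyhedron_extreme_points[OF polytope_imp_polyhedron[OF assms]] by simp
qed

lemma polytope_vertices_subset:
  assumes "polytope P"
  shows "polytope_vertices P \<subseteq> P"
  using mem_polytope_vertices_iff[OF assms] by (auto simp: extreme_point_of_def)

lemma face_vertices:
  assumes "polytope P" "F face_of P"
  shows "F \<inter> polytope_vertices P = {x. x extreme_point_of F}"
  using extreme_point_of_face[OF assms(2)] mem_polytope_vertices_iff[OF assms(1)] by auto

lemma face_eq_convex_hull_vertices:
  assumes "polytope P" "F face_of P"
  shows "F = convex hull (F \<inter> polytope_vertices P)"
proof -
  have "polytope F"
    using assms face_of_polytope_polytope by blast
  then show ?thesis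
    unfolding face_vertices[OF assms]
    by (intro Krein_Milman_Minkowski polytope_imp_compact polytope_imp_convex)
qed

lemma face_subset_halfspace:
  assumes "polytope P" "F face_of P" "\<And>v. v \<in> F \<inter> polytope_vertices P \<Longrightarrow> c \<bullet> v \<le> b"
    and "x \<in> F"
  shows "c \<bullet> x \<le> b"
proof -
  have "convex hull (F \<inter> polytope_vertices P) \<subseteq> {x. c \<bullet> x \<le> b}"
    using assms(3) by (intro hull_minimal) (auto simp: convex_halfspace_le)
  then show ?thesis
    using assms face_eq_convex_hull_vertices by blast
qed

lemma mem_polytope_edges_iff:
  assumes "polytope P"
  shows "{u, v} \<in> polytope_edges P \<longleftrightarrow> u \<noteq> v \<and> closed_segment u v face_of P"
proof -
  have ex: "F exposed_face_of P \<longleftrightarrow> F face_of P" for F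
    using assms exposed_face_of_polyhedron polytope_imp_polyhedron by blast
  show ?thesis
  proof
    assume "{u, v} \<in> polytope_edges P"
    then obtain e where e: "e exposed_face_of P" "aff_dim e = 1" "{u, v} = e \<inter> polytope_vertices P"
      by (auto simp: polytope_edges_def)
    obtain x y where "x \<noteq> y" "e = closed_segment x y" "{u, v} = {x, y}"
      using polytope_edge_endpoints[OF assms e(1,2)] e(3) by metis
    then show "u \<noteq> v \<and> closed_segment u v face_of P"
      using e(1) by (auto simp: ex doubleton_eq_iff closed_segment_commute)
  next
    assume a: "u \<noteq> v \<and> closed_segment u v face_of P"
    have "aff_dim (closed_segment u v) = 1"
      using a by (simp add: segment_convex_hull aff_dim_convex_hull)
    moreover have "closed_segment u v \<inter> polytope_vertices P = {u, v}"
      using a by (auto simp: face_vertices[OF assms] extreme_point_of_segment)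
    ultimately show "{u, v} \<in> polytope_edges P"
      using a unfolding polytope_edges_def ex by (intro image_eqI[of _ _ "closed_segment u v"]) auto
  qed
qed

lemma simple_graph_polytope:
  assumes "polytope P"
  shows "simple_graph (polytope_vertices P) (polytope_edges P)"
  unfolding simple_graph_def
proof
  fix e assume "e \<in> polytope_edges P"
  then obtain f where f: "f exposed_face_of P" "aff_dim f = 1" "e = f \<inter> polytope_vertices P"
    by (auto simp: polytope_edges_def)
  obtain u v where "u \<noteq> v" "e = {u, v}"
    using polytope_edge_endpoints[OF assms f(1,2)] f(3) by metis
  then show "\<exists>u\<in>polytope_vertices P. \<exists>v\<in>polytope_vertices P. u \<noteq> v \<and> e = {u, v}"
    using f(3) by blast
qed

lemma proper_face_simplex:
  assumes "simplicial_polytope P" "F face_of P" "F \<noteq> P"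
  obtains n where "n simplex F"
proof -
  have "F exposed_face_of P"
    using assms exposed_face_of_polyhedron polytope_imp_polyhedron
    unfolding simplicial_polytope_def by blast
  then show thesis
    using assms that unfolding simplicial_polytope_def by blast
qed

lemma simplex_extreme_points:
  assumes "n simplex F"
  shows "\<not> affine_dependent {x. x extreme_point_of F}"
    and "F = convex hull {x. x extreme_point_of F}"
    and "int (card {x. x extreme_point_of F}) = aff_dim F + 1"
proof -
  obtain D where D: "\<not> affine_dependent D" "int (card D) = n + 1" "F = convex hull D"
    using assms by (auto simp: simplex_def)
  then have "{x. x extreme_point_of F} = D"
    by (simp add: extreme_point_of_convex_hull_affine_independent)
  then show "\<not> affine_dependent {x. x extreme_point_of F}"
    "F = convex hull {x. x extreme_point_of F}"
    "int (card {x. x extreme_point_of F}) = aff_dim F + 1"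
    using D aff_dim_simplex[OF assms] by auto
qed

lemma vertices_of_proper_face_adjacent:
  assumes P: "simplicial_polytope P" and F: "F face_of P" "F \<noteq> P"
    and uv: "u \<in> F" "v \<in> F" "u \<in> polytope_vertices P" "v \<in> polytope_vertices P" "u \<noteq> v"
  shows "{u, v} \<in> polytope_edges P"
proof -
  have poly: "polytope P"
    using P by (simp add: simplicial_polytope_def)
  let ?D = "{x. x extreme_point_of F}"
  obtain n where n: "n simplex F"
    using proper_face_simplex[OF P F] .
  have "{u, v} \<subseteq> ?D"
    using uv face_vertices[OF poly F(1)] by blast
  then have "convex hull {u, v} face_of convex hull ?D"
    using face_of_convex_hull_affine_independent[OF simplex_extreme_points(1)[OF n]] by blast
  then have "closed_segment u v face_of F"
    using simplex_extreme_points(2)[OF n] by (simp add: segment_convex_hull)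
  then show ?thesis
    using face_of_trans F(1) uv(5) by (auto simp: mem_polytope_edges_iff[OF poly])
qed

lemma card_facet_vertices:
  assumes P: "simplicial_polytope P" "aff_dim P = int d" and F: "F facet_of P"
  shows "card (F \<inter> polytope_vertices P) = d"
proof -
  have poly: "polytope P"
    using P by (simp add: simplicial_polytope_def)
  have F': "F face_of P" "F \<noteq> P" "aff_dim F = aff_dim P - 1"
    using F by (auto simp: facet_of_def)
  obtain n where n: "n simplex F"
    using proper_face_simplex[OF P(1) F'(1,2)] .
  show ?thesis
    using simplex_extreme_points(3)[OF n] F'(3) P(2) face_vertices[OF poly F'(1)] by simp
qed

text \<open>
  A facet through the edge is a simplex with \<open>d\<close> vertices, all adjacent to both \<open>u\<close> and \<open>v\<close>, which
  gives \<open>d - 2\<close> common neighbours. As the edge is the intersection of the facets containing it and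
  is not a facet itself when \<open>d \<ge> 3\<close>, there is a second facet through it, and it provides one more.
\<close>

lemma common_neighbours_ge:
  assumes d: "3 \<le> d" and P: "simplicial_polytope P" "aff_dim P = int d"
    and uv: "{u, v} \<in> polytope_edges P"
  shows "d - 1 \<le> card {w. {u, w} \<in> polytope_edges P \<and> {v, w} \<in> polytope_edges P}"
proof -
  have poly: "polytope P"
    using P by (simp add: simplicial_polytope_def)
  let ?V = "polytope_vertices P" and ?e = "closed_segment u v"
  let ?W = "{w. {u, w} \<in> polytope_edges P \<and> {v, w} \<in> polytope_edges P}"
  have e: "u \<noteq> v" "?e face_of P"
    using uv by (auto simp: mem_polytope_edges_iff[OF poly])
  have V: "u \<in> ?V" "v \<in> ?V"
    using simple_graph_edgeD[OF simple_graph_polytope[OF poly] uv] by auto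
  have dim: "aff_dim ?e = 1"
    using e by (simp add: segment_convex_hull aff_dim_convex_hull)
  then have "?e \<noteq> P"
    using d P(2) by auto
  then have int: "?e = \<Inter>{h. h facet_of P \<and> ?e \<subseteq> h}"
    using face_of_polyhedron[OF polytope_imp_polyhedron[OF poly] e(2)] by simp
  obtain F where F: "F facet_of P" "?e \<subseteq> F"
    using face_of_polyhedron_subset_facet[OF polytope_imp_polyhedron[OF poly] e(2)] \<open>?e \<noteq> P\<close>
    by auto
  have "\<not> F \<subseteq> ?e"
  proof
    assume "F \<subseteq> ?e"
    then have "aff_dim F \<le> 1"
      using aff_dim_subset dim by metis
    then show False
      using F(1) d P(2) by (simp add: facet_of_def)
  qed
  then obtain F' where F': "F' facet_of P" "?e \<subseteq> F'" "\<not> F \<subseteq> F'"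
    using int by blast
  have faces: "F face_of P" "F \<noteq> P" "F' face_of P" "F' \<noteq> P"
    using F F' by (auto simp: facet_of_def)
  have "\<not> F \<inter> ?V \<subseteq> F'"
  proof
    assume "F \<inter> ?V \<subseteq> F'"
    then have "convex hull (F \<inter> ?V) \<subseteq> F'"
      using face_of_imp_convex[OF faces(3)] polytope_imp_convex[OF poly] by (intro hull_minimal) auto
    then show False
      using F'(3) face_eq_convex_hull_vertices[OF poly faces(1)] by simp
  qed
  then obtain x where x: "x \<in> F" "x \<in> ?V" "x \<notin> F'"
    by blast
  have in_F: "u \<in> F" "v \<in> F" "u \<in> F'" "v \<in> F'"
    using F(2) F'(2) by auto
  have "insert x (F' \<inter> ?V - {u, v}) \<subseteq> ?W"
    using x in_F V vertices_of_proper_face_adjacent[OF P(1) faces(1,2)]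
      vertices_of_proper_face_adjacent[OF P(1) faces(3,4)] by auto
  moreover have "?W \<subseteq> ?V"
    using simple_graph_edgeD[OF simple_graph_polytope[OF poly]] by blast
  then have "finite ?W"
    using finite_polytope_vertices[OF poly] finite_subset by blast
  moreover have "card (insert x (F' \<inter> ?V - {u, v})) = d - 1"
    using x in_F V e(1) finite_polytope_vertices[OF poly] card_facet_vertices[OF P F'(1)] d
    by (simp add: card_Diff_subset)
  ultimately show ?thesis
    using card_mono[of ?W "insert x (F' \<inter> ?V - {u, v})"] by simp
qed

section \<open>Connectivity of the graph of a simplicial polytope\<close>

text \<open>
  A hyperplane through a relative interior point of a set of dimension at least \<open>2\<close> contains a
  segment of that set with the point in its middle.
\<close>

lemma extreme_point_of_section_notin_rel_interior:
  assumes "2 \<le> aff_dim P" and e: "e extreme_point_of (P \<inter> {x. a \<bullet> x = s})"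
  shows "e \<notin> rel_interior P"
proof
  assume int: "e \<in> rel_interior P"
  have eP: "e \<in> P" "a \<bullet> e = s"
    using e by (auto simp: extreme_point_of_def)
  let ?L = "affine hull P \<inter> {x. a \<bullet> x = s}"
  have "e \<in> ?L"
    using eP by (simp add: hull_inc)
  moreover have "aff_dim ?L \<noteq> 0"
    using \<open>e \<in> ?L\<close> assms(1) aff_dim_affine_Int_hyperplane[OF affine_affine_hull, of P a s]
    by (auto split: if_splits)
  then have "?L \<noteq> {e}"
    by (metis aff_dim_sing)
  ultimately obtain y where y: "y \<in> ?L" "y \<noteq> e"
    by blast
  obtain r where r: "r > 0" "cball e r \<inter> affine hull P \<subseteq> P"
    using int by (auto simp: mem_rel_interior_cball)
  define t where "t = r / norm (y - e)"
  have t: "t > 0" "t * norm (y - e) = r"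
    using r y by (auto simp: t_def)
  have mem: "e + q *\<^sub>R (y - e) \<in> P \<inter> {x. a \<bullet> x = s}" if "\<bar>q\<bar> = t" for q
  proof -
    have "(1 - q) *\<^sub>R e + q *\<^sub>R y \<in> affine hull P"
      using mem_affine[OF affine_affine_hull, of e P y "1 - q" q] y \<open>e \<in> ?L\<close> by auto
    then have "e + q *\<^sub>R (y - e) \<in> affine hull P"
      by (simp add: algebra_simps)
    moreover have "e + q *\<^sub>R (y - e) \<in> cball e r"
      using that t by (simp add: dist_norm)
    ultimately show ?thesis
      using r(2) y eP by (auto simp: inner_add_right inner_diff_right)
  qed
  define g where "g = t *\<^sub>R (y - e)"
  have mem': "e + g \<in> P \<inter> {x. a \<bullet> x = s}" "e - g \<in> P \<inter> {x. a \<bullet> x = s}"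
    using mem[of t] mem[of "- t"] t(1) by (simp_all add: g_def)
  have "e = midpoint (e + g) (e - g)"
    by (simp add: midpoint_def scaleR_2[symmetric])
  moreover have "2 *\<^sub>R g = (e + g) - (e - g)"
    by (simp add: scaleR_2)
  moreover have "g \<noteq> 0"
    using t(1) y(2) by (simp add: g_def)
  ultimately have "e = midpoint (e + g) (e - g)" "e + g \<noteq> e - g"
    by (simp, metis right_minus_eq scaleR_eq_0_iff zero_neq_numeral)
  then have "e \<in> open_segment (e + g) (e - g)"
    by (metis midpoint_in_open_segment)
  then show False
    using e mem' unfolding extreme_point_of_def by blast
qed

text \<open>
  The optimality criterion of the simplex algorithm: a vertex that is not maximal has a neighbour
  with larger value. Cut \<open>P\<close> by a hyperplane so close to \<open>w\<close> that all other vertices lie beyond it.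
  The segment from \<open>w\<close> to \<open>x\<close> shows that the section contains a point with value above \<open>c \<bullet> w\<close>,
  hence so does one of the extreme points of the section. This extreme point lies on a facet of
  \<open>P\<close>, which must contain \<open>w\<close> because its points are not all beyond the hyperplane. The facet has a
  vertex with value above \<open>c \<bullet> w\<close>, and this vertex is adjacent to \<open>w\<close> as the facet is a simplex.
\<close>

lemma ascending_neighbour:
  assumes P: "simplicial_polytope P" "2 \<le> aff_dim P"
    and w: "w \<in> polytope_vertices P" and x: "x \<in> polytope_vertices P" "c \<bullet> w < c \<bullet> x"
  obtains u where "u \<in> polytope_vertices P" "{w, u} \<in> polytope_edges P" "c \<bullet> w < c \<bullet> u"
proof -
  have poly: "polytope P"
    using P by (simp add: simplicial_polytope_def)
  let ?V = "polytope_vertices P"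
  have VP: "?V \<subseteq> P"
    using polytope_vertices_subset[OF poly] .
  obtain a b where ab: "P \<subseteq> {y. a \<bullet> y \<le> b}" "{w} = P \<inter> {y. a \<bullet> y = b}"
    using w by (auto simp: polytope_vertices_def exposed_face_of_def)
  have less: "a \<bullet> v < b" if "v \<in> ?V - {w}" for v
    using that ab VP by (metis (mono_tags, lifting) Diff_iff IntI in_mono mem_Collect_eq order_le_less)
  have wb: "a \<bullet> w = b"
    using ab(2) by auto
  define m where "m = Max ((\<bullet>) a ` (?V - {w}))"
  have fin: "finite (?V - {w})" and xw: "x \<in> ?V - {w}"
    using finite_polytope_vertices[OF poly] x by auto
  have "m \<in> (\<bullet>) a ` (?V - {w})"
    unfolding m_def using fin xw by (intro Max_in) auto
  then have "m < b"
    using less by auto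
  have le_m: "a \<bullet> v \<le> m" if "v \<in> ?V - {w}" for v
    unfolding m_def using fin that by (intro Max_ge) auto
  define s where "s = (m + b) / 2"
  have s: "m < s" "s < b"
    using \<open>m < b\<close> by (auto simp: s_def)
  define K where "K = P \<inter> {y. a \<bullet> y = s}"
  have K: "compact K" "convex K"
    unfolding K_def using poly polytope_imp_compact polytope_imp_convex
    by (auto intro!: compact_Int_closed closed_hyperplane convex_Int convex_hyperplane)
  \<comment> \<open>The parameter at which the segment from \<open>w\<close> to \<open>x\<close> crosses the hyperplane.\<close>
  define t where "t = (b - s) / (b - a \<bullet> x)"
  have t: "0 < t" "t < 1"
    using s le_m[OF xw] by (auto simp: t_def field_simps)
  define z where "z = (1 - t) *\<^sub>R w + t *\<^sub>R x"
  have "z \<in> P"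
    unfolding z_def using t VP w x polytope_imp_convex[OF poly]
    by (intro convexD) auto
  moreover have "a \<bullet> z = b - t * (b - a \<bullet> x)"
    by (simp add: z_def inner_add_right wb algebra_simps)
  then have "a \<bullet> z = s"
    using less[OF xw] by (simp add: t_def)
  ultimately have "z \<in> K"
    by (simp add: K_def)
  have "c \<bullet> z - c \<bullet> w = t * (c \<bullet> x - c \<bullet> w)"
    by (simp add: z_def inner_add_right algebra_simps)
  then have cz: "c \<bullet> w < c \<bullet> z"
    using t x(2) by (metis diff_gt_0_iff_gt mult_pos_pos)
  have "\<exists>e. e extreme_point_of K \<and> c \<bullet> w < c \<bullet> e"
  proof (rule ccontr)
    assume "\<not> ?thesis"
    then have "{e. e extreme_point_of K} \<subseteq> {y. c \<bullet> y \<le> c \<bullet> w}"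
      by (auto simp: not_less)
    then have "convex hull {e. e extreme_point_of K} \<subseteq> {y. c \<bullet> y \<le> c \<bullet> w}"
      by (intro hull_minimal) (auto simp: convex_halfspace_le)
    then show False
      using \<open>z \<in> K\<close> cz Krein_Milman_Minkowski[OF K] by auto
  qed
  then obtain e where e: "e extreme_point_of K" "c \<bullet> w < c \<bullet> e"
    by blast
  have eK: "e \<in> P" "a \<bullet> e = s"
    using e(1) by (auto simp: extreme_point_of_def K_def)
  have "e \<in> rel_frontier P"
    using extreme_point_of_section_notin_rel_interior[OF P(2) e(1)[unfolded K_def]] eK(1)
      closure_subset by (auto simp: rel_frontier_def)
  then obtain F where F: "F facet_of P" "e \<in> F"
    using rel_frontier_of_polyhedron[OF polytope_imp_polyhedron[OF poly]] by auto
  have face: "F face_of P" "F \<noteq> P"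
    using F by (auto simp: facet_of_def)
  have "w \<in> F"
  proof (rule ccontr)
    assume "w \<notin> F"
    then have "a \<bullet> e \<le> m"
      using face_subset_halfspace[OF poly face(1) _ F(2), of a m] le_m by auto
    then show False
      using s eK by simp
  qed
  moreover obtain u where u: "u \<in> F \<inter> ?V" "c \<bullet> w < c \<bullet> u"
    using face_subset_halfspace[OF poly face(1) _ F(2), of c "c \<bullet> w"] e(2) by (meson not_le)
  ultimately have "{w, u} \<in> polytope_edges P"
    using vertices_of_proper_face_adjacent[OF P(1) face, of w u] w by auto
  then show thesis
    using that u by auto
qed

text \<open>
  If no edge joined \<open>A\<close> to \<open>B\<close>, then an ascent that starts in \<open>A\<close> or in \<open>B\<close> at a value of at least \<open>b\<close>
  would stay there, since the deleted vertices \<open>S\<close> all lie at level \<open>b\<close>. So both sides would contain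
  a maximal vertex. The maximal vertices span a proper face, since \<open>v\<close> lies below \<open>p\<close>, and in a
  simplicial polytope any two of them are adjacent.
\<close>

lemma edge_across_upper_side:
  assumes P: "simplicial_polytope P" "2 \<le> aff_dim P"
    and AB: "A \<union> B = polytope_vertices P - S"
    and S: "\<And>x. x \<in> S \<Longrightarrow> c \<bullet> x = b"
    and p: "p \<in> polytope_vertices P" "b < c \<bullet> p"
    and v: "v \<in> A" "c \<bullet> v = b" and w: "w \<in> B" "b \<le> c \<bullet> w" and "A \<inter> B = {}"
  shows "\<exists>x\<in>A. \<exists>y\<in>B. {x, y} \<in> polytope_edges P"
proof (rule ccontr)
  assume no: "\<not> ?thesis"
  have poly: "polytope P"
    using P by (simp add: simplicial_polytope_def)
  let ?V = "polytope_vertices P"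
  have finV: "finite ?V"
    using finite_polytope_vertices[OF poly] .
  have VP: "?V \<subseteq> P"
    using polytope_vertices_subset[OF poly] .
  have top: "\<exists>u\<in>X. \<forall>y\<in>?V. c \<bullet> y \<le> c \<bullet> u"
    if X: "X \<subseteq> ?V" "q \<in> X" "b \<le> c \<bullet> q"
      and closed: "\<And>x y. x \<in> X \<Longrightarrow> y \<in> ?V - S \<Longrightarrow> {x, y} \<in> polytope_edges P \<Longrightarrow> y \<in> X" for X q
  proof -
    have "finite X" "X \<noteq> {}"
      using X finV finite_subset by auto
    then have "Max ((\<bullet>) c ` X) \<in> (\<bullet>) c ` X"
      by (intro Max_in) auto
    then obtain u where "u \<in> X" "Max ((\<bullet>) c ` X) = c \<bullet> u"
      by blast
    then have u: "u \<in> X" "\<And>y. y \<in> X \<Longrightarrow> c \<bullet> y \<le> c \<bullet> u"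
      using Max_ge[of "(\<bullet>) c ` X"] \<open>finite X\<close> by force+
    have "c \<bullet> y \<le> c \<bullet> u" if y: "y \<in> ?V" for y
    proof (rule ccontr)
      assume "\<not> c \<bullet> y \<le> c \<bullet> u"
      then have "c \<bullet> u < c \<bullet> y" "u \<in> ?V"
        using u(1) X(1) by auto
      then obtain u' where u': "u' \<in> ?V" "{u, u'} \<in> polytope_edges P" "c \<bullet> u < c \<bullet> u'"
        using ascending_neighbour[OF P _ y] by metis
      have "b < c \<bullet> u'"
        using u(2)[OF X(2)] X(3) u'(3) by linarith
      then have "u' \<in> ?V - S"
        using S u'(1) by auto
      then have "u' \<in> X"
        using closed u(1) u'(2) by blast
      then show False
        using u(2) u'(3) by force
    qed
    then show ?thesis
      using u(1) by blast
  qed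
  obtain s where s: "s \<in> A" "\<And>y. y \<in> ?V \<Longrightarrow> c \<bullet> y \<le> c \<bullet> s"
  proof -
    have "y \<in> A" if "x \<in> A" "y \<in> ?V - S" "{x, y} \<in> polytope_edges P" for x y
      using that AB no by blast
    then have "\<exists>u\<in>A. \<forall>y\<in>?V. c \<bullet> y \<le> c \<bullet> u"
      using top[of A v] AB v by blast
    then show thesis
      using that by blast
  qed
  obtain t where t: "t \<in> B" "\<And>y. y \<in> ?V \<Longrightarrow> c \<bullet> y \<le> c \<bullet> t"
  proof -
    have "y \<in> B" if "x \<in> B" "y \<in> ?V - S" "{x, y} \<in> polytope_edges P" for x y
      using that AB no by (metis UnE insert_commute)
    then have "\<exists>u\<in>B. \<forall>y\<in>?V. c \<bullet> y \<le> c \<bullet> u"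
      using top[of B w] AB w by blast
    then show thesis
      using that by blast
  qed
  have stV: "s \<in> ?V" "t \<in> ?V" "v \<in> ?V"
    using AB s(1) t(1) v(1) by auto
  have eq: "c \<bullet> t = c \<bullet> s"
    using s(2) t(2) stV by (meson order_antisym)
  let ?F = "P \<inter> {y. c \<bullet> y = c \<bullet> s}"
  have "c \<bullet> y \<le> c \<bullet> s" if "y \<in> P" for y
    using face_subset_halfspace[OF poly face_of_refl[OF polytope_imp_convex[OF poly]] _ that] s(2)
    by auto
  then have face: "?F face_of P"
    using face_of_Int_supporting_hyperplane_le[OF polytope_imp_convex[OF poly]] by blast
  have "v \<notin> ?F"
    using v(2) s(2)[OF p(1)] p(2) by auto
  then have "?F \<noteq> P"
    using stV VP by auto
  moreover have "s \<in> ?F" "t \<in> ?F" "s \<noteq> t"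
    using stV VP eq s(1) t(1) \<open>A \<inter> B = {}\<close> by auto
  ultimately have "{s, t} \<in> polytope_edges P"
    using vertices_of_proper_face_adjacent[OF P(1) face] stV by blast
  then show False
    using no s(1) t(1) by blast
qed

text \<open>
  The normal vector is the component of \<open>p - v\<close> orthogonal to the direction space of
  \<open>affine hull T\<close>.
\<close>

lemma hyperplane_through_affine_hull_avoiding:
  fixes T :: "'a::euclidean_space set"
  assumes "v \<in> T" "p \<notin> affine hull T"
  obtains c where "\<And>x. x \<in> T \<Longrightarrow> c \<bullet> x = c \<bullet> v" "c \<bullet> p \<noteq> c \<bullet> v"
proof -
  let ?L = "(\<lambda>x. x - v) ` T"
  obtain y z where yz: "y \<in> span ?L" "\<And>w. w \<in> span ?L \<Longrightarrow> orthogonal z w" "p - v = y + z"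
    using orthogonal_subspace_decomp_exists[of ?L "p - v"] by metis
  have hull: "affine hull T = (+) v ` span ((\<lambda>x. x - v) ` (T - {v}))"
    using affine_hull_span2[OF assms(1)] by (simp add: uminus_add_conv_diff)
  have "z \<noteq> 0"
  proof
    assume "z = 0"
    then have "p = v + y" "y \<in> span ?L"
      using yz by (auto simp: algebra_simps)
    moreover have "span ?L = span ((\<lambda>x. x - v) ` (T - {v}))"
    proof -
      have "?L = insert 0 ((\<lambda>x. x - v) ` (T - {v}))"
        using assms(1) by auto
      then show ?thesis
        by (simp add: span_insert_0)
    qed
    ultimately show False
      using assms(2) hull by auto
  qed
  have "z \<bullet> x = z \<bullet> v" if "x \<in> T" for x
    using yz(2)[of "x - v"] that span_base[of "x - v" ?L]
    by (auto simp: orthogonal_def inner_diff_right)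
  moreover have "z \<bullet> (p - v) = z \<bullet> z"
    using yz by (simp add: inner_add_right orthogonal_def)
  then have "z \<bullet> p \<noteq> z \<bullet> v"
    using \<open>z \<noteq> 0\<close> by (auto simp: inner_diff_right)
  ultimately show thesis
    using that by blast
qed

lemma aff_dim_polytope_vertices:
  assumes "polytope P"
  shows "aff_dim (polytope_vertices P) = aff_dim P"
  using face_eq_convex_hull_vertices[OF assms face_of_refl[OF polytope_imp_convex[OF assms]]]
    polytope_vertices_subset[OF assms]
  by (metis Int_absorb1 aff_dim_convex_hull)

text \<open>
  Balinski's theorem for simplicial polytopes. The deleted set \<open>S\<close> together with a vertex \<open>v\<close> in \<open>A\<close>
  has at most \<open>d\<close> points, so some functional is constant on it but not on \<open>P\<close>. As \<open>v\<close> lies at the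
  level of \<open>S\<close>, both the ascent and the descent are open to it; a vertex \<open>w\<close> in \<open>B\<close> decides which
  of the two is used.
\<close>

lemma simplicial_polytope_removal_connected:
  assumes P: "simplicial_polytope P" "aff_dim P = int d" "2 \<le> d"
  shows "removal_connected d (polytope_vertices P) (polytope_edges P)"
  unfolding removal_connected_def
proof (intro allI impI, elim conjE)
  let ?V = "polytope_vertices P"
  fix S A B
  assume S: "S \<subseteq> ?V" "card S < d" and AB: "A \<union> B = ?V - S" "A \<inter> B = {}" "A \<noteq> {}" "B \<noteq> {}"
  have poly: "polytope P"
    using P by (simp add: simplicial_polytope_def)
  have dim: "2 \<le> aff_dim P"
    using P by simp
  obtain v w where vw: "v \<in> A" "w \<in> B"
    using AB by auto
  have "finite S"
    using S(1) finite_polytope_vertices[OF poly] finite_subset by blast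
  then have "card (insert v S) \<le> d"
    using S(2) by (simp add: card_insert_if)
  moreover have "aff_dim (insert v S) \<le> int (card (insert v S)) - 1"
    using \<open>finite S\<close> aff_dim_le_card by blast
  ultimately have "aff_dim (insert v S) < aff_dim ?V"
    using P(2) aff_dim_polytope_vertices[OF poly] by linarith
  then have "\<not> ?V \<subseteq> affine hull (insert v S)"
    using aff_dim_subset[of ?V "affine hull (insert v S)"] by (metis aff_dim_affine_hull not_less)
  then obtain q where q: "q \<in> ?V" "q \<notin> affine hull (insert v S)"
    by blast
  obtain c where c: "\<And>x. x \<in> insert v S \<Longrightarrow> c \<bullet> x = c \<bullet> v" "c \<bullet> q \<noteq> c \<bullet> v"
    using hyperplane_through_affine_hull_avoiding[OF _ q(2)] by blast
  \<comment> \<open>\<open>p\<close> shows that the functional is not constant, and \<open>w\<close> lies on the side of \<open>p\<close> or at the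
    level of \<open>v\<close>.\<close>
  define p where "p = (if c \<bullet> w = c \<bullet> v then q else w)"
  have p: "p \<in> ?V" "c \<bullet> p \<noteq> c \<bullet> v" "c \<bullet> w = c \<bullet> v \<or> w = p"
    using q(1) c(2) vw(2) AB(1) by (auto simp: p_def)
  show "\<exists>a\<in>A. \<exists>b\<in>B. {a, b} \<in> polytope_edges P"
  proof (cases "c \<bullet> v < c \<bullet> p")
    case True
    then have "c \<bullet> v \<le> c \<bullet> w"
      using p(3) by auto
    moreover have "c \<bullet> x = c \<bullet> v" if "x \<in> S" for x
      using c(1)[of x] that by simp
    ultimately show ?thesis
      by (intro edge_across_upper_side[OF P(1) dim AB(1) _ p(1) True vw(1) refl vw(2) _ AB(2)])
  next
    case False
    then have less: "(- c) \<bullet> v < (- c) \<bullet> p"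
      using p(2) by simp
    then have "(- c) \<bullet> v \<le> (- c) \<bullet> w"
      using p(3) by auto
    moreover have "(- c) \<bullet> x = (- c) \<bullet> v" if "x \<in> S" for x
      using c(1)[of x] that by simp
    ultimately show ?thesis
      by (intro edge_across_upper_side[OF P(1) dim AB(1) _ p(1) less vw(1) refl vw(2) _ AB(2)])
  qed
qed

section \<open>The bound for simplicial polytopes\<close>

theorem corollary11:
  fixes P :: "'a::euclidean_space set" and d :: nat and C :: "'a set set"
  assumes "d \<ge> 3"
    and "simplicial_polytope P"
    and "aff_dim P = int d"
    and "minimum_edge_cut (polytope_vertices P) (polytope_edges P) C"
    and "\<not> trivial_edge_cut (polytope_vertices P) (polytope_edges P) C"
  shows "real (card C) \<ge> real d * (real d + 1) / 2"
proof -
  have poly: "polytope P"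
    using assms(2) by (simp add: simplicial_polytope_def)
  have fin: "finite (polytope_vertices P)"
    using finite_polytope_vertices[OF poly] .
  have "d < card (polytope_vertices P)"
    using aff_dim_le_card[OF fin] aff_dim_polytope_vertices[OF poly] assms(3) by linarith
  moreover have "removal_connected d (polytope_vertices P) (polytope_edges P)"
    using simplicial_polytope_removal_connected[OF assms(2,3)] assms(1) by simp
  ultimately have "d * (d + 1) \<le> 2 * card C"
    using card_nontrivial_minimum_cut_ge[OF fin _ _ simple_graph_polytope[OF poly]
        common_neighbours_ge[OF assms(1-3)] assms(4,5)] by blast
  then have "real (d * (d + 1)) \<le> real (2 * card C)"
    by (rule of_nat_mono)
  then show ?thesis
    by (simp add: algebra_simps)
qed

end
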